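(* Let $(U_{(y,z)})_{(y,z)\in\mathbb{Z}^2}$, $(V_{(x,z)})_{(x,z)\in\mathbb{Z}^2}$, $(W_{(x,y)})_{(x,y)\in\mathbb{Z}^2}$ be families of random variables with values in $\{-1,1\}$, all independent, each equal to $+1$ or $-1$ with probability $1/2$. Define $F:\mathbb{Z}^3\to\mathbb{Z}^3$ by $F(x,y,z)=(x+U_{(y,z)},\,y+V_{(x,z)},\,z+W_{(x,y)})$, let $Z=(Z_n)_{n\ge0}$ be given by $Z_0=(0,0,0)$ and $Z_{n+1}=F(Z_n)$, and let $\omega$ be the directed graph on $\mathbb{Z}^3$ with edge set $\{(a,F(a)):a\in\mathbb{Z}^3\}$. Then: (i) almost surely, the path $Z$ is eventually periodic; (ii) almost surely, every connected component of $\omega$ is bounded.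
   Context: The variables are the orientations of the lines of $\mathbb{Z}^3$ parallel to the three coordinate axes. Connected components are those of the underlying undirected graph. A sequence $(Z_n)$ is eventually periodic if there are $N\ge0$ and $p\ge1$ with $Z_{n+p}=Z_n$ for all $n\ge N$. *)

theory Defs
  imports "HOL-Probability.Probability" "Graph_Theory.Digraph_Component"
begin

type_synonym point = "int \<times> int \<times> int"

definition line_map ::
  "(int \<times> int \<Rightarrow> int) \<Rightarrow> (int \<times> int \<Rightarrow> int) \<Rightarrow> (int \<times> int \<Rightarrow> int) \<Rightarrow> point \<Rightarrow> point" where
  "line_map u v w = (\<lambda>(x, y, z). (x + u (y, z), y + v (x, z), z + w (x, y)))"

primrec path_from_origin :: "(point \<Rightarrow> point) \<Rightarrow> nat \<Rightarrow> point" where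
  "path_from_origin F 0 = (0, 0, 0)"
| "path_from_origin F (Suc n) = F (path_from_origin F n)"

definition eventually_periodic :: "(nat \<Rightarrow> 'a) \<Rightarrow> bool" where
  "eventually_periodic Z \<longleftrightarrow> (\<exists>N p. p \<ge> 1 \<and> (\<forall>n\<ge>N. Z (n + p) = Z n))"

definition functional_digraph :: "('a \<Rightarrow> 'a) \<Rightarrow> ('a, 'a \<times> 'a) pre_digraph" where
  "functional_digraph F = \<lparr>verts = UNIV, arcs = {(a, F a) | a. True}, tail = fst, head = snd\<rparr>"

(* The constant connected of Digraph_Component (qualified because of the topological notion of the
   same name) is connectedness of the underlying undirected graph, for nonempty graphs. *)
definition connected_components :: "('a, 'b) pre_digraph \<Rightarrow> ('a, 'b) pre_digraph set" where
  "connected_components G = {C. pre_digraph.max_subgraph G Digraph_Component.connected C}"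

(* Type int carries no metric in the library, so boundedness is taken in Euclidean 3-space. *)
definition bounded_points :: "point set \<Rightarrow> bool" where
  "bounded_points S \<longleftrightarrow>
     bounded ((\<lambda>(x, y, z). (real_of_int x, real_of_int y, real_of_int z)) ` S)"

end

theory Submission
  imports Defs
begin

text \<open>
  The key is that the path cannot escape in any coordinate direction, say that of increasing \<open>x\<close>.
  When the path reaches a new maximal value of \<open>x\<close>, the two lines through its position in the other
  two directions have not been seen before. If the line in direction \<open>x\<close> points backwards there, then
  with probability \<open>1/4\<close> the path returns to the point it came from and is trapped in a cycle of
  length two. Trapping happens at most once, so the expected number of such records is at most \<open>4\<close>,
  and almost surely there are finitely many
  (\<open>AE_finitely_many_records_followed_by_retreat\<close>). If \<open>x\<close> were unbounded above, then every late
  record would be followed by a step forward, which is again a record, and from some time on \<open>x\<close>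
  would increase in every step.

  Such a march has probability zero. While it lasts, each new line in direction \<open>x\<close> stops it with
  probability \<open>1/2\<close>, so only finitely many of them are met
  (\<open>AE_finitely_many_new_lines_on_march\<close>); but the \<open>y\<close>-steps of the march are fresh fair coins, which
  do not allow \<open>y\<close> to return infinitely often to its largest recurrent value without exceeding it
  (\<open>AE_finitely_many_visits_to_maximal_y_on_march\<close>). All three estimates come from one principle,
  \<open>AE_finitely_many_trials\<close>, in which disjointness of the successes takes the place of independence of
  the trials; the probability of success is bounded by flipping fresh bits (\<open>query_fresh_bit\<close>).

  By symmetry all coordinates are bounded in both directions, so every orbit takes finitely many
  values and is eventually periodic. Consequently each component contains a cycle, and all its points
  reach that cycle. By translation invariance the expected number of points that reach a given
  point of return time \<open>L\<close> is at most \<open>L\<close> (\<open>AE_finite_basin\<close>), so the component is finite.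
\<close>

section \<open>Fair bits and fresh trials\<close>

abbreviation coin :: "bool pmf" where "coin \<equiv> pmf_of_set UNIV"

text \<open>Orientations are recorded as booleans rather than as signs, so that the product space is a full
function space and every map and event below is defined everywhere.\<close>
definition fair_bits :: "('i \<Rightarrow> bool) measure" where
  "fair_bits = (\<Pi>\<^sub>M i\<in>UNIV. measure_pmf coin)"

interpretation fair_bits: prob_space "fair_bits :: ('i \<Rightarrow> bool) measure"
  unfolding fair_bits_def by (intro prob_space_PiM measure_pmf.prob_space_axioms)

lemma space_fair_bits [simp]: "space fair_bits = UNIV"
  by (auto simp: fair_bits_def space_PiM)

lemma measurable_bit [measurable]: "(\<lambda>e. e i) \<in> fair_bits \<rightarrow>\<^sub>M count_space UNIV"
proof -
  have "(\<lambda>e. e i) \<in> fair_bits \<rightarrow>\<^sub>M measure_pmf coin"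
    unfolding fair_bits_def by (rule measurable_component_singleton) simp
  then show ?thesis by (simp cong: measurable_cong_sets)
qed

lemma measurable_to_fair_bits:
  assumes "\<And>i. (\<lambda>x. X i x) \<in> M \<rightarrow>\<^sub>M count_space UNIV"
  shows "(\<lambda>x i. X i x) \<in> M \<rightarrow>\<^sub>M fair_bits"
proof -
  have "(\<lambda>x. \<lambda>i\<in>UNIV. X i x) \<in> M \<rightarrow>\<^sub>M fair_bits"
    unfolding fair_bits_def using assms
    by (intro measurable_restrict) (simp cong: measurable_cong_sets)
  then show ?thesis by (simp only: restrict_UNIV)
qed

lemma emeasure_coin: "emeasure (measure_pmf coin) {b} = 1 / 2"
proof -
  have "pmf coin b = 1/2" by (simp add: card_UNIV_bool)
  moreover have "ennreal (1/2) = 1/2"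
    by (metis ennreal_divide_numeral ennreal_1 zero_le_one)
  ultimately show ?thesis by (simp add: emeasure_pmf_single)
qed

lemma distr_eq_fair_bits:
  assumes "prob_space M" 
    and indep: "prob_space.indep_vars M (\<lambda>_. count_space UNIV) (X :: 'i \<Rightarrow> 'a \<Rightarrow> bool) UNIV"
    and fair: "\<And>i. measure M {x \<in> space M. X i x} = 1 / 2"
  shows "distr M fair_bits (\<lambda>x i. X i x) = fair_bits"
proof -
  interpret prob_space M by fact
  have indep': "indep_vars (\<lambda>_. measure_pmf coin) X UNIV"
    using indep unfolding indep_vars_def by (simp cong: measurable_cong_sets)
  have rv: "X i \<in> M \<rightarrow>\<^sub>M measure_pmf coin" for i
    using indep' unfolding indep_vars_def by auto
  have half: "ennreal (1/2) = 1/2"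
    by (metis ennreal_divide_numeral ennreal_1 zero_le_one)
  have coin: "distr M (measure_pmf coin) (X i) = measure_pmf coin" for i
  proof (rule measure_eqI_countable[where A=UNIV])
    fix b :: bool
    have m: "{x \<in> space M. X i x} \<in> events"
      using measurable_sets[OF rv, of "{True}" i] by (simp add: vimage_def Int_def conj_commute)
    have "prob {x \<in> space M. X i x = b} = 1 / 2"
    proof (cases b)
      case True then show ?thesis using fair[of i] by simp
    next
      case False
      have "{x \<in> space M. X i x = b} = space M - {x \<in> space M. X i x}" using False by auto
      then show ?thesis using prob_compl[OF m] fair[of i] by simp
    qed
    moreover have "X i -` {b} \<inter> space M = {x \<in> space M. X i x = b}" by auto
    ultimately have "emeasure M (X i -` {b} \<inter> space M) = 1 / 2"
      by (simp only: emeasure_eq_measure half)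
    then show "emeasure (distr M (measure_pmf coin) (X i)) {b} = emeasure (measure_pmf coin) {b}"
      using rv[of i] by (simp add: emeasure_distr emeasure_coin)
  qed auto
  have "distr M (\<Pi>\<^sub>M i\<in>UNIV. measure_pmf coin) (\<lambda>x. \<lambda>i\<in>UNIV. X i x)
        = (\<Pi>\<^sub>M i\<in>UNIV. distr M (measure_pmf coin) (X i))"
    using indep' by (subst (asm) indep_vars_iff_distr_eq_PiM') (use rv in auto)
  then show ?thesis by (simp only: coin fair_bits_def restrict_UNIV)
qed

text \<open>The coordinates stay independent and fair when they are permuted and when a fixed set of them is
negated. Flipping one bit and the symmetries of the lattice are both of this form.\<close>
lemma distr_reindex_xor:
  fixes \<pi> :: "'i \<Rightarrow> 'i" and c :: "'i \<Rightarrow> bool"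
  assumes "inj \<pi>"
  shows "distr fair_bits fair_bits (\<lambda>e i. e (\<pi> i) \<noteq> c i) = (fair_bits :: ('i \<Rightarrow> bool) measure)"
proof -
  have coin: "distr fair_bits (measure_pmf coin) (\<lambda>e :: 'i \<Rightarrow> bool. e i) = measure_pmf coin" for i
    unfolding fair_bits_def 
    by (intro product_prob_space.PiM_component product_prob_spaceI measure_pmf.prob_space_axioms) simp
  have mb: "(\<lambda>e. e i) \<in> fair_bits \<rightarrow>\<^sub>M measure_pmf coin" for i :: 'i
    using measurable_bit[of i] by (simp cong: measurable_cong_sets)
  have r: "distr fair_bits fair_bits (\<lambda>e. \<lambda>i\<in>UNIV. e (\<pi> i)) = (fair_bits :: ('i \<Rightarrow> bool) measure)"
    unfolding fair_bits_def using assms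
    by (intro distr_PiM_reindex[where M="\<lambda>_. measure_pmf coin"] measure_pmf.prob_space_axioms) auto
  have "fair_bits.indep_vars (\<lambda>_. measure_pmf coin) (\<lambda>i e. e (\<pi> i)) UNIV"
    using r by (subst fair_bits.indep_vars_iff_distr_eq_PiM') (simp_all only: coin mb fair_bits_def[symmetric], simp_all)
  then have "fair_bits.indep_vars (\<lambda>_. count_space UNIV) (\<lambda>i e. e (\<pi> i) \<noteq> c i) UNIV"
    by (rule fair_bits.indep_vars_compose2) auto
  moreover have "fair_bits.prob {e \<in> space fair_bits. e (\<pi> i) \<noteq> c i} = 1 / 2" for i
  proof -
    have "fair_bits.prob {e \<in> space fair_bits. e (\<pi> i) \<noteq> c i}
        = measure (distr fair_bits (measure_pmf coin) (\<lambda>e. e (\<pi> i))) {\<not> c i}"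
      by (subst measure_distr) (auto simp: mb intro!: arg_cong[where f="measure _"])
    also have "\<dots> = 1/2" by (simp only: coin) (simp add: measure_pmf_single card_UNIV_bool)
    finally show ?thesis .
  qed
  ultimately show ?thesis by (intro distr_eq_fair_bits) (auto intro: fair_bits.prob_space_axioms)
qed

definition flip :: "'i \<Rightarrow> ('i \<Rightarrow> bool) \<Rightarrow> 'i \<Rightarrow> bool" where
  "flip i e = e(i := \<not> e i)"

lemma flip_apply: "flip i e j = (if j = i then \<not> e j else e j)"
  by (simp add: flip_def)

lemma distr_flip: "distr fair_bits fair_bits (flip i) = fair_bits"
proof -
  have "flip i = (\<lambda>e j. e (id j) \<noteq> (j = i))" by (auto simp: fun_eq_iff flip_apply)
  then show ?thesis using distr_reindex_xor[of id "\<lambda>j. j = i"] by simp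
qed

lemma measurable_flip [measurable]: "flip i \<in> fair_bits \<rightarrow>\<^sub>M fair_bits"
proof -
  have "(\<lambda>e j. flip i e j) \<in> fair_bits \<rightarrow>\<^sub>M fair_bits"
    by (rule measurable_to_fair_bits) (simp add: flip_apply)
  then show ?thesis by simp
qed

text \<open>Let \<open>q\<close> choose a bit depending on the environment, in such a way that flipping the chosen bit
preserves both the event \<open>B\<close> and the choice: given \<open>B\<close>, the bit is fresh. If one of its two values
leads to \<open>T\<close>, then \<open>T\<close> has conditional probability at least \<open>1/2\<close> given \<open>B\<close>. Indeed, for each value \<open>i\<close>
of \<open>q\<close>, the measure-preserving flip of \<open>i\<close> carries the part of \<open>B\<close> outside \<open>T\<close> into the part inside.\<close>
lemma query_fresh_bit:
  fixes q :: "('i::countable \<Rightarrow> bool) \<Rightarrow> 'i"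
  assumes B [measurable]: "B \<in> sets fair_bits" and T [measurable]: "T \<in> sets fair_bits"
    and q [measurable]: "q \<in> fair_bits \<rightarrow>\<^sub>M count_space UNIV"
    and inv: "\<And>e. e \<in> B \<Longrightarrow> flip (q e) e \<in> B" "\<And>e. e \<in> B \<Longrightarrow> q (flip (q e) e) = q e"
    and hit: "\<And>e. e \<in> B \<Longrightarrow> e \<in> T \<or> flip (q e) e \<in> T"
  shows "emeasure fair_bits B \<le> 2 * emeasure fair_bits (B \<inter> T)"
proof -
  define C where "C i = {e \<in> space fair_bits. e \<in> B \<inter> T \<and> q e = i}" for i
  define D where "D i = {e \<in> space fair_bits. e \<in> B - T \<and> q e = i}" for i
  have C [measurable]: "C i \<in> sets fair_bits" and D [measurable]: "D i \<in> sets fair_bits" for i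
    unfolding C_def D_def by measurable
  have le: "emeasure fair_bits (D i) \<le> emeasure fair_bits (C i)" for i
  proof -
    have "emeasure fair_bits (D i) \<le> emeasure fair_bits (flip i -` C i \<inter> space fair_bits)"
      using inv hit by (intro emeasure_mono measurable_sets[OF measurable_flip C]) (auto simp: C_def D_def)
    also have "\<dots> = emeasure (distr fair_bits fair_bits (flip i)) (C i)"
      by (rule emeasure_distr[symmetric]) measurable
    finally show ?thesis by (simp add: distr_flip)
  qed
  have UC: "(\<Union>i. C i) = B \<inter> T" and UD: "(\<Union>i. D i) = B - T"
    by (auto simp: C_def D_def)
  have "emeasure fair_bits (B - T) = (\<integral>\<^sup>+i. emeasure fair_bits (D i) \<partial>count_space UNIV)"
    unfolding UD[symmetric] by (rule emeasure_UN_countable) (auto simp: disjoint_family_on_def D_def[of "_"] D)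
  also have "\<dots> \<le> (\<integral>\<^sup>+i. emeasure fair_bits (C i) \<partial>count_space UNIV)"
    by (intro nn_integral_mono le)
  also have "\<dots> = emeasure fair_bits (B \<inter> T)"
    unfolding UC[symmetric] by (rule emeasure_UN_countable[symmetric]) (auto simp: disjoint_family_on_def C_def[of "_"] C)
  finally have "emeasure fair_bits (B \<inter> T) + emeasure fair_bits (B - T) \<le> 2 * emeasure fair_bits (B \<inter> T)"
    by (simp add: mult_2 add_left_mono)
  moreover have "emeasure fair_bits (B \<inter> T) + emeasure fair_bits (B - T) = emeasure fair_bits B"
    by (subst plus_emeasure) (auto intro!: arg_cong[where f="emeasure _"])
  ultimately show ?thesis by simp
qed

text \<open>The first Borel--Cantelli lemma, for an arbitrary countable index type: the number of
occurrences has finite expectation.\<close>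
lemma AE_finite_occurrences:
  fixes A :: "'b::countable \<Rightarrow> 'a set"
  assumes A [measurable]: "\<And>b. A b \<in> sets M" 
    and fin: "(\<integral>\<^sup>+b. emeasure M (A b) \<partial>count_space UNIV) < \<infinity>"
  shows "AE x in M. finite {b. x \<in> A b}"
proof -
  have "(\<integral>\<^sup>+x. \<integral>\<^sup>+b. indicator (A b) x \<partial>count_space UNIV \<partial>M) = (\<integral>\<^sup>+b. emeasure M (A b) \<partial>count_space UNIV)"
    by (subst nn_integral_count_space_nn_integral) auto
  moreover have "(\<lambda>z. indicator (A (snd z)) (fst z) :: ennreal) \<in> borel_measurable (M \<Otimes>\<^sub>M count_space UNIV)"
    by (rule measurable_compose_countable[where f="\<lambda>b z. indicator (A b) (fst z)"]) measurable
  then have "(\<lambda>x. \<integral>\<^sup>+b. indicator (A b) x \<partial>count_space UNIV) \<in> borel_measurable M"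
    by (intro sigma_finite_measure.borel_measurable_nn_integral sigma_finite_measure_count_space)
       (simp add: case_prod_unfold)
  ultimately have "AE x in M. (\<integral>\<^sup>+b. indicator (A b) x \<partial>count_space UNIV) \<noteq> \<infinity>"
    using fin by (intro nn_integral_PInf_AE) simp_all
  then show ?thesis
  proof eventually_elim
    case (elim x)
    have "(\<integral>\<^sup>+b. indicator (A b) x \<partial>count_space UNIV) = (\<integral>\<^sup>+b. indicator {b. x \<in> A b} b \<partial>count_space UNIV)"
      by (intro nn_integral_cong) (simp add: indicator_def)
    also have "\<dots> = emeasure (count_space UNIV) {b. x \<in> A b}" by simp
    finally show ?case using elim by (auto simp: emeasure_count_space split: if_splits)
  qed
qed

text \<open>At most one of the successes \<open>T n\<close> can happen, so their expected number is at most \<open>1\<close>, and the expected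
number of trials \<open>B n\<close> is at most \<open>c\<close>.\<close>
lemma AE_finitely_many_trials:
  fixes B T :: "nat \<Rightarrow> 'a set"
  assumes "prob_space M"
    and B [measurable]: "\<And>n. B n \<in> sets M" and T [measurable]: "\<And>n. T n \<in> sets M"
    and le: "\<And>n. emeasure M (B n) \<le> c * emeasure M (T n)" and c: "c < \<infinity>"
    and disj: "\<And>x m n. m < n \<Longrightarrow> x \<in> T m \<Longrightarrow> x \<notin> T n"
  shows "AE x in M. finite {n. x \<in> B n}"
proof (rule AE_finite_occurrences)
  interpret prob_space M by fact
  have "disjoint_family T"
    unfolding disjoint_family_on_def using disj by (metis disjoint_iff linorder_neqE_nat)
  then have "(\<integral>\<^sup>+n. emeasure M (T n) \<partial>count_space UNIV) = emeasure M (\<Union>n. T n)"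
    by (intro emeasure_UN_countable[symmetric]) auto
  also have "\<dots> \<le> 1" by (simp add: emeasure_le_1)
  finally have T1: "(\<integral>\<^sup>+n. emeasure M (T n) \<partial>count_space UNIV) \<le> 1" .
  have "(\<integral>\<^sup>+n. emeasure M (B n) \<partial>count_space UNIV) \<le> (\<integral>\<^sup>+n. c * emeasure M (T n) \<partial>count_space UNIV)"
    by (intro nn_integral_mono le)
  also have "\<dots> = c * (\<integral>\<^sup>+n. emeasure M (T n) \<partial>count_space UNIV)"
    by (rule nn_integral_cmult) simp
  also have "\<dots> \<le> c * 1" by (intro mult_left_mono T1) simp
  also have "\<dots> < \<infinity>" using c by simp
  finally show "(\<integral>\<^sup>+n. emeasure M (B n) \<partial>count_space UNIV) < \<infinity>" .
qed (rule B)

section \<open>Lines, environments and orbits\<close>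

text \<open>A line parallel to an axis is named by its two constant coordinates, the three summands of \<open>line\<close>
standing for the three directions.\<close>
type_synonym line = "int \<times> int + int \<times> int + int \<times> int"
type_synonym env = "line \<Rightarrow> bool"

fun x_of :: "point \<Rightarrow> int" where "x_of (x, y, z) = x"
fun y_of :: "point \<Rightarrow> int" where "y_of (x, y, z) = y"
fun z_of :: "point \<Rightarrow> int" where "z_of (x, y, z) = z"

fun x_line :: "point \<Rightarrow> line" where "x_line (x, y, z) = Inl (y, z)"
fun y_line :: "point \<Rightarrow> line" where "y_line (x, y, z) = Inr (Inl (x, z))"
fun z_line :: "point \<Rightarrow> line" where "z_line (x, y, z) = Inr (Inr (x, y))"

abbreviation unit_step :: "bool \<Rightarrow> int" where "unit_step b \<equiv> (if b then 1 else -1)"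

definition env_map :: "env \<Rightarrow> point \<Rightarrow> point" where
  "env_map e = line_map (\<lambda>l. unit_step (e (Inl l))) (\<lambda>l. unit_step (e (Inr (Inl l)))) (\<lambda>l. unit_step (e (Inr (Inr l))))"

abbreviation orbit :: "env \<Rightarrow> point \<Rightarrow> nat \<Rightarrow> point" where
  "orbit e p n \<equiv> (env_map e ^^ n) p"

lemma env_map_coordinates [simp]:
  "x_of (env_map e p) = x_of p + unit_step (e (x_line p))"
  "y_of (env_map e p) = y_of p + unit_step (e (y_line p))"
  "z_of (env_map e p) = z_of p + unit_step (e (z_line p))"
  by (cases p; simp add: env_map_def line_map_def)+

lemma point_eq_iff: "p = q \<longleftrightarrow> x_of p = x_of q \<and> y_of p = y_of q \<and> z_of p = z_of q"
  by (cases p; cases q; simp)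

lemma line_distinct [simp]:
  "x_line p \<noteq> y_line q" "x_line p \<noteq> z_line q" "y_line p \<noteq> x_line q"
  "y_line p \<noteq> z_line q" "z_line p \<noteq> x_line q" "z_line p \<noteq> y_line q"
  by (cases p; cases q; simp)+

lemma line_eq_iff:
  "x_line p = x_line q \<longleftrightarrow> y_of p = y_of q \<and> z_of p = z_of q"
  "y_line p = y_line q \<longleftrightarrow> x_of p = x_of q \<and> z_of p = z_of q"
  "z_line p = z_line q \<longleftrightarrow> x_of p = x_of q \<and> y_of p = y_of q"
  by (cases p; cases q; simp)+

lemma env_map_cong:
  assumes "e (x_line p) = e' (x_line p)" "e (y_line p) = e' (y_line p)" "e (z_line p) = e' (z_line p)"
  shows "env_map e p = env_map e' p"
  unfolding point_eq_iff env_map_coordinates using assms by presburger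

text \<open>The first \<open>n\<close> steps of an orbit see only the lines through the first \<open>n\<close> points, so the orientations
of all other lines are still fresh.\<close>
lemma orbit_flip:
  assumes fresh: "\<And>k. k < n \<Longrightarrow> i \<noteq> x_line (orbit e p k) \<and> i \<noteq> y_line (orbit e p k) \<and> i \<noteq> z_line (orbit e p k)"
    and "k \<le> n"
  shows "orbit (flip i e) p k = orbit e p k"
  using \<open>k \<le> n\<close>
proof (induction k)
  case (Suc k)
  then have eq: "orbit (flip i e) p k = orbit e p k" and k: "k < n" by simp_all
  have "env_map (flip i e) (orbit e p k) = env_map e (orbit e p k)"
    using fresh[OF k] by (intro env_map_cong) (auto simp only: flip_apply split: if_splits)
  then show ?case by (simp only: funpow.simps comp_apply eq)
qed simp

lemma measurable_env_map: "(\<lambda>e. env_map e p) \<in> fair_bits \<rightarrow>\<^sub>M count_space UNIV"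
proof -
  have [measurable]: "Measurable.pred fair_bits (\<lambda>e :: env. a + unit_step (e i) = b)" for a b i
    by (rule measurable_compose[OF measurable_bit]) simp
  have "(\<lambda>e. env_map e p) -` {q} \<inter> space fair_bits \<in> sets fair_bits" for q
  proof -
    have "(\<lambda>e. env_map e p) -` {q} \<inter> space fair_bits = {e \<in> space fair_bits. x_of p + unit_step (e (x_line p)) = x_of q \<and>
        y_of p + unit_step (e (y_line p)) = y_of q \<and> z_of p + unit_step (e (z_line p)) = z_of q}"
      unfolding vimage_def Int_def mem_Collect_eq singleton_iff point_eq_iff[of _ q] env_map_coordinates by blast
    also have "\<dots> \<in> sets fair_bits" by measurable
    finally show ?thesis .
  qed
  then show ?thesis by (subst measurable_count_space_eq2_countable) auto
qed

lemma measurable_orbit [measurable]: "(\<lambda>e. orbit e p n) \<in> fair_bits \<rightarrow>\<^sub>M count_space UNIV"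
proof (induction n)
  case (Suc n)
  have "(\<lambda>e. env_map e (orbit e p n)) \<in> fair_bits \<rightarrow>\<^sub>M count_space UNIV"
    by (rule measurable_compose_countable[OF measurable_env_map Suc])
  then show ?case by simp
qed simp

lemma pred_orbit: "Measurable.pred fair_bits (\<lambda>e. P (orbit e p n))"
  by (rule measurable_compose[OF measurable_orbit]) simp

lemma pred_orbit2: "Measurable.pred fair_bits (\<lambda>e. R (orbit e p k) (orbit e p n))"
  by (rule measurable_compose_countable[where f="\<lambda>a e. R a (orbit e p n)", OF pred_orbit measurable_orbit])

text \<open>At a record, the path enters a plane of constant \<open>x\<close> for the first time. That plane contains
the two lines through the current point in the other two directions, so they are fresh.\<close>
definition x_record :: "env \<Rightarrow> point \<Rightarrow> nat \<Rightarrow> bool" where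
  "x_record e p n \<longleftrightarrow> (\<forall>k<n. x_of (orbit e p k) < x_of (orbit e p n))"

definition x_marches :: "env \<Rightarrow> point \<Rightarrow> nat \<Rightarrow> bool" where
  "x_marches e p n \<longleftrightarrow> (\<forall>k\<le>n. x_of (orbit e p k) = x_of p + int k)"

lemma measurable_x_record [measurable]: "Measurable.pred fair_bits (\<lambda>e. x_record e p n)"
  unfolding x_record_def by (intro pred_intros_countable pred_intros_logic pred_orbit2)

lemma measurable_x_marches [measurable]: "Measurable.pred fair_bits (\<lambda>e. x_marches e p n)"
  unfolding x_marches_def by (intro pred_intros_countable pred_intros_logic pred_orbit)

lemma orbit_Suc: "orbit e p (Suc n) = env_map e (orbit e p n)"
  by simp

lemma orbit_add: "orbit e p (m + n) = orbit e (orbit e p m) n"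
  by (simp only: add.commute[of m] funpow_add comp_apply)

lemma x_record_fresh:
  assumes "x_record e p n" and "k \<le> n" and "i = y_line (orbit e p n) \<or> i = z_line (orbit e p n)"
  shows "orbit (flip i e) p k = orbit e p k"
proof (rule orbit_flip[OF _ \<open>k \<le> n\<close>])
  fix j assume "j < n"
  then have "x_of (orbit e p j) \<noteq> x_of (orbit e p n)" using assms(1) by (auto simp: x_record_def)
  then show "i \<noteq> x_line (orbit e p j) \<and> i \<noteq> y_line (orbit e p j) \<and> i \<noteq> z_line (orbit e p j)"
    using assms(3) by (elim disjE) (simp_all add: line_eq_iff)
qed

lemma x_record_flip:
  assumes "x_record e p n" and "i = y_line (orbit e p n) \<or> i = z_line (orbit e p n)"
  shows "x_record (flip i e) p n"
  using assms x_record_fresh[OF assms(1) _ assms(2)] unfolding x_record_def by (metis less_imp_le order_refl)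

lemma x_marches_imp_x_record: "x_marches e p n \<Longrightarrow> x_record e p n"
  by (auto simp: x_marches_def x_record_def)

lemma measurable_lines_on_orbit [measurable]:
  "(\<lambda>e. x_line (orbit e p n)) \<in> fair_bits \<rightarrow>\<^sub>M count_space UNIV"
  "(\<lambda>e. y_line (orbit e p n)) \<in> fair_bits \<rightarrow>\<^sub>M count_space UNIV"
  "(\<lambda>e. z_line (orbit e p n)) \<in> fair_bits \<rightarrow>\<^sub>M count_space UNIV"
  by (rule measurable_compose[OF measurable_orbit], simp)+

section \<open>Records and marches\<close>

lemma step_back:
  assumes "(b :: int) = a + unit_step s" "c = b + unit_step t" "d = b + unit_step (\<not> t)"
  shows "c = a \<or> d = a"
  using assms by (cases s; cases t; simp)

text \<open>Suppose that the path reaches \<open>q\<close> from \<open>p'\<close> with a new maximal value of \<open>x\<close>, and that \<open>x\<close> decreases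
in the next step. That step also uses the two fresh lines through \<open>q\<close>, and with probability \<open>1/4\<close> it
leads back to \<open>p'\<close>. Then the path alternates between \<open>p'\<close> and \<open>q\<close> and there are no further records;
so this happens at most once, and the expected number of such records is at most \<open>4\<close>.\<close>
lemma AE_finitely_many_records_followed_by_retreat:
  "AE e in fair_bits. finite {n. x_record e p (Suc n) \<and>
     x_of (orbit e p (Suc (Suc n))) < x_of (orbit e p (Suc n))}"
proof -
  define B where "B n = {e. x_record e p (Suc n) \<and> x_of (orbit e p (Suc (Suc n))) < x_of (orbit e p (Suc n))}" for n
  define Ty where "Ty n = {e. y_of (orbit e p (Suc (Suc n))) = y_of (orbit e p n)}" for n
  define Tz where "Tz n = {e. z_of (orbit e p (Suc (Suc n))) = z_of (orbit e p n)}" for n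
  have meas [measurable]: "B n \<in> sets fair_bits" "Ty n \<in> sets fair_bits" "Tz n \<in> sets fair_bits" for n
  proof -
    have "{e \<in> space fair_bits. x_record e p (Suc n) \<and> x_of (orbit e p (Suc (Suc n))) < x_of (orbit e p (Suc n))} \<in> sets fair_bits"
      using pred_orbit2[of "\<lambda>a b. x_of b < x_of a" "Suc (Suc n)" p "Suc n"] by measurable
    then show "B n \<in> sets fair_bits" by (simp only: B_def space_fair_bits UNIV_I simp_thms)
    show "Ty n \<in> sets fair_bits"
      using pred_orbit2[of "\<lambda>a b. y_of a = y_of b" "Suc (Suc n)" p n] by (simp only: Ty_def pred_def space_fair_bits UNIV_I simp_thms)
    show "Tz n \<in> sets fair_bits"
      using pred_orbit2[of "\<lambda>a b. z_of a = z_of b" "Suc (Suc n)" p n] by (simp only: Tz_def pred_def space_fair_bits UNIV_I simp_thms)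
  qed
  have le: "emeasure fair_bits (B n) \<le> 4 * emeasure fair_bits (B n \<inter> Ty n \<inter> Tz n)" for n
  proof -
    have B_flip: "flip i e \<in> B n" and eq: "\<And>k. k \<le> Suc n \<Longrightarrow> orbit (flip i e) p k = orbit e p k"
      if "e \<in> B n" and i: "i = y_line (orbit e p (Suc n)) \<or> i = z_line (orbit e p (Suc n))" for e i
    proof -
      have r: "x_record e p (Suc n)" using that by (simp only: B_def mem_Collect_eq)
      show eq: "orbit (flip i e) p k = orbit e p k" if "k \<le> Suc n" for k
        by (rule x_record_fresh[OF r that i])
      have "flip i e (x_line (orbit e p (Suc n))) = e (x_line (orbit e p (Suc n)))"
        using i by (auto simp only: flip_apply line_distinct split: if_splits)
      then show "flip i e \<in> B n"
        using x_record_flip[OF r i] \<open>e \<in> B n\<close>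
        by (simp only: B_def mem_Collect_eq orbit_Suc[of "Suc n"] eq[OF order_refl] env_map_coordinates)
    qed
    \<comment> \<open>One factor \<open>2\<close> for each of the two fresh lines.\<close>
    have "emeasure fair_bits (B n) \<le> 2 * emeasure fair_bits (B n \<inter> Ty n)"
    proof (rule query_fresh_bit[where q="\<lambda>e. y_line (orbit e p (Suc n))"])
      fix e assume e: "e \<in> B n"
      let ?f = "flip (y_line (orbit e p (Suc n))) e"
      show "?f \<in> B n" using e by (intro B_flip) blast+
      have eq': "\<And>k. k \<le> Suc n \<Longrightarrow> orbit ?f p k = orbit e p k" using e by (intro eq) blast+
      have eqn: "orbit ?f p n = orbit e p n" by (rule eq') simp
      show "y_line (orbit ?f p (Suc n)) = y_line (orbit e p (Suc n))" by (simp only: eq' order_refl)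
      have "y_of (orbit e p (Suc n)) = y_of (orbit e p n) + unit_step (e (y_line (orbit e p n)))"
        by (simp only: orbit_Suc env_map_coordinates)
      moreover have "y_of (orbit e p (Suc (Suc n))) = y_of (orbit e p (Suc n)) + unit_step (e (y_line (orbit e p (Suc n))))"
        by (simp only: orbit_Suc[of "Suc n"] env_map_coordinates)
      moreover have "y_of (orbit ?f p (Suc (Suc n))) = y_of (orbit e p (Suc n)) + unit_step (\<not> e (y_line (orbit e p (Suc n))))"
        by (simp only: orbit_Suc[of "Suc n"] eq'[OF order_refl] env_map_coordinates flip_apply simp_thms if_True)
      ultimately show "e \<in> Ty n \<or> ?f \<in> Ty n"
        unfolding Ty_def mem_Collect_eq eqn by (rule step_back)
    qed measurable
    also have "emeasure fair_bits (B n \<inter> Ty n) \<le> 2 * emeasure fair_bits (B n \<inter> Ty n \<inter> Tz n)"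
    proof (rule query_fresh_bit[where q="\<lambda>e. z_line (orbit e p (Suc n))"])
      fix e assume "e \<in> B n \<inter> Ty n"
      then have e: "e \<in> B n" and ey: "e \<in> Ty n" by blast+
      let ?f = "flip (z_line (orbit e p (Suc n))) e"
      have eq': "\<And>k. k \<le> Suc n \<Longrightarrow> orbit ?f p k = orbit e p k" using e by (intro eq) blast+
      have eqn: "orbit ?f p n = orbit e p n" by (rule eq') simp
      have "y_of (orbit ?f p (Suc (Suc n))) = y_of (orbit e p (Suc (Suc n)))"
        by (simp only: orbit_Suc[of "Suc n"] eq'[OF order_refl] env_map_coordinates flip_apply line_distinct if_False)
      then have "?f \<in> Ty n" using ey by (simp only: Ty_def mem_Collect_eq eqn)
      moreover have "?f \<in> B n" using e by (intro B_flip) blast+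
      ultimately show "?f \<in> B n \<inter> Ty n" by blast
      show "z_line (orbit ?f p (Suc n)) = z_line (orbit e p (Suc n))" by (simp only: eq' order_refl)
      have "z_of (orbit e p (Suc n)) = z_of (orbit e p n) + unit_step (e (z_line (orbit e p n)))"
        by (simp only: orbit_Suc env_map_coordinates)
      moreover have "z_of (orbit e p (Suc (Suc n))) = z_of (orbit e p (Suc n)) + unit_step (e (z_line (orbit e p (Suc n))))"
        by (simp only: orbit_Suc[of "Suc n"] env_map_coordinates)
      moreover have "z_of (orbit ?f p (Suc (Suc n))) = z_of (orbit e p (Suc n)) + unit_step (\<not> e (z_line (orbit e p (Suc n))))"
        by (simp only: orbit_Suc[of "Suc n"] eq'[OF order_refl] env_map_coordinates flip_apply simp_thms if_True)
      ultimately show "e \<in> Tz n \<or> ?f \<in> Tz n"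
        unfolding Tz_def mem_Collect_eq eqn by (rule step_back)
    qed measurable
    finally show ?thesis by (simp add: mult_left_mono mult.assoc[symmetric])
  qed
  have "AE e in fair_bits. finite {n. e \<in> B n}"
  proof (rule AE_finitely_many_trials[where T="\<lambda>n. B n \<inter> Ty n \<inter> Tz n", OF fair_bits.prob_space_axioms _ _ le])
    fix e m n assume "m < n" and e: "e \<in> B m \<inter> Ty m \<inter> Tz m"
    have "x_of (orbit e p m) < x_of (orbit e p (Suc m))"
      using e by (auto simp only: B_def x_record_def Int_iff mem_Collect_eq)
    moreover have "x_of (orbit e p (Suc m)) = x_of (orbit e p m) + unit_step (e (x_line (orbit e p m)))"
      by (simp only: orbit_Suc env_map_coordinates)
    moreover have "x_of (orbit e p (Suc (Suc m))) = x_of (orbit e p (Suc m)) + unit_step (e (x_line (orbit e p (Suc m))))"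
      by (simp only: orbit_Suc[of "Suc m"] env_map_coordinates)
    moreover have "x_of (orbit e p (Suc (Suc m))) < x_of (orbit e p (Suc m))"
      using e by (simp only: B_def Int_iff mem_Collect_eq)
    ultimately have "x_of (orbit e p (Suc (Suc m))) = x_of (orbit e p m)" by (smt (verit))
    \<comment> \<open>From here on the orbit has period \<open>2\<close>.\<close>
    then have loop: "orbit e p (m + 2) = orbit e p m"
      using e by (simp only: point_eq_iff Ty_def Tz_def Int_iff mem_Collect_eq add_2_eq_Suc')
    have "orbit e p (Suc n) = orbit e p ((m + 2) + (n - 1 - m))"
      using \<open>m < n\<close> by (intro arg_cong[where f="orbit e p"]) simp
    also have "\<dots> = orbit e p (n - 1)"
      using \<open>m < n\<close> unfolding orbit_add[of "m + 2"] loop orbit_add[symmetric]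
      by (intro arg_cong[where f="orbit e p"]) simp
    finally have "\<not> x_record e p (Suc n)"
      unfolding x_record_def using \<open>m < n\<close> by (metis diff_le_self le_imp_less_Suc less_irrefl)
    then show "e \<notin> B n \<inter> Ty n \<inter> Tz n" by (simp only: B_def Int_iff mem_Collect_eq simp_thms not_False_eq_True)
  qed (auto simp: meas)
  then show ?thesis by (simp only: B_def mem_Collect_eq)
qed

text \<open>As long as \<open>x\<close> increases in every step, each line in direction \<open>x\<close> that is met for the first time
has a fresh orientation and ends the march with probability \<open>1/2\<close>.\<close>
lemma AE_finitely_many_new_lines_on_march:
  "AE e in fair_bits. finite {n. x_marches e p n \<and> (\<forall>k<n. x_line (orbit e p k) \<noteq> x_line (orbit e p n))}"
proof -
  define B where "B n = {e. x_marches e p n \<and> (\<forall>k<n. x_line (orbit e p k) \<noteq> x_line (orbit e p n))}" for n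
  define T where "T n = {e. x_of (orbit e p (Suc n)) < x_of (orbit e p n)}" for n
  have meas [measurable]: "B n \<in> sets fair_bits" "T n \<in> sets fair_bits" for n
  proof -
    have "Measurable.pred fair_bits (\<lambda>e. x_marches e p n \<and> (\<forall>k<n. x_line (orbit e p k) \<noteq> x_line (orbit e p n)))"
      by (intro pred_intros_countable pred_intros_logic pred_orbit2 measurable_x_marches)
    then show "B n \<in> sets fair_bits" by (simp only: B_def pred_def space_fair_bits UNIV_I simp_thms)
    show "T n \<in> sets fair_bits"
      using pred_orbit2[of "\<lambda>a b. x_of a < x_of b" "Suc n" p n] by (simp only: T_def pred_def space_fair_bits UNIV_I simp_thms)
  qed
  have le: "emeasure fair_bits (B n) \<le> 2 * emeasure fair_bits (B n \<inter> T n)" for n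
  proof (rule query_fresh_bit[where q="\<lambda>e. x_line (orbit e p n)"])
    fix e assume e: "e \<in> B n"
    let ?f = "flip (x_line (orbit e p n)) e"
    have eq: "orbit ?f p k = orbit e p k" if "k \<le> n" for k
    proof (rule orbit_flip[OF _ that])
      fix j assume "j < n"
      then have "x_line (orbit e p j) \<noteq> x_line (orbit e p n)" using e by (simp add: B_def)
      then show "x_line (orbit e p n) \<noteq> x_line (orbit e p j) \<and> x_line (orbit e p n) \<noteq> y_line (orbit e p j)
          \<and> x_line (orbit e p n) \<noteq> z_line (orbit e p j)"
        by (simp only: line_distinct not_False_eq_True simp_thms not_sym)
    qed
    show "?f \<in> B n" using e eq by (simp add: B_def x_marches_def)
    show "x_line (orbit ?f p n) = x_line (orbit e p n)" by (simp only: eq order_refl)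
    show "e \<in> T n \<or> ?f \<in> T n"
      unfolding T_def mem_Collect_eq orbit_Suc eq[OF order_refl] env_map_coordinates flip_apply by simp
  qed measurable
  have "AE e in fair_bits. finite {n. e \<in> B n}"
  proof (rule AE_finitely_many_trials[where T="\<lambda>n. B n \<inter> T n", OF fair_bits.prob_space_axioms _ _ le])
    fix e m n assume "m < n" and e: "e \<in> B m \<inter> T m"
    have "x_of (orbit e p m) = x_of p + int m"
      using e by (simp add: B_def x_marches_def)
    then have "x_of (orbit e p (Suc m)) \<noteq> x_of p + int (Suc m)"
      using e by (simp only: T_def Int_iff mem_Collect_eq) simp
    then have "\<not> x_marches e p n" using \<open>m < n\<close> unfolding x_marches_def by (metis Suc_leI)
    then show "e \<notin> B n \<inter> T n" by (simp only: B_def Int_iff mem_Collect_eq simp_thms not_False_eq_True)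
  qed (auto simp: meas)
  then show ?thesis by (simp only: B_def mem_Collect_eq)
qed

text \<open>As long as \<open>x\<close> increases in every step, each step in direction \<open>y\<close> is fresh. Hence the path can attain
the height \<open>b\<close>, without ever having exceeded it, only finitely often before it steps up to \<open>b + 1\<close>.\<close>
lemma AE_finitely_many_visits_to_maximal_y_on_march:
  "AE e in fair_bits. finite {n. x_marches e p n \<and> (\<forall>k\<le>n. y_of (orbit e p k) \<le> b) \<and> y_of (orbit e p n) = b}"
proof -
  define B where "B n = {e. x_marches e p n \<and> (\<forall>k\<le>n. y_of (orbit e p k) \<le> b) \<and> y_of (orbit e p n) = b}" for n
  define T where "T n = {e. y_of (orbit e p (Suc n)) = b + 1}" for n
  have meas [measurable]: "B n \<in> sets fair_bits" "T n \<in> sets fair_bits" for n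
  proof -
    have "Measurable.pred fair_bits (\<lambda>e. x_marches e p n \<and> (\<forall>k\<le>n. y_of (orbit e p k) \<le> b) \<and> y_of (orbit e p n) = b)"
      by (intro pred_intros_countable pred_intros_logic pred_orbit measurable_x_marches)
    then show "B n \<in> sets fair_bits" by (simp only: B_def pred_def space_fair_bits UNIV_I simp_thms)
    show "T n \<in> sets fair_bits"
      using pred_orbit[of "\<lambda>a. y_of a = b + 1" "Suc n" p] by (simp only: T_def pred_def space_fair_bits UNIV_I simp_thms)
  qed
  have le: "emeasure fair_bits (B n) \<le> 2 * emeasure fair_bits (B n \<inter> T n)" for n
  proof (rule query_fresh_bit[where q="\<lambda>e. y_line (orbit e p n)"])
    fix e assume e: "e \<in> B n"
    let ?f = "flip (y_line (orbit e p n)) e"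
    have "x_record e p n" using e by (simp add: B_def x_marches_imp_x_record)
    then have eq: "orbit ?f p k = orbit e p k" if "k \<le> n" for k
      using that by (rule x_record_fresh) simp
    show "?f \<in> B n" using e eq by (simp add: B_def x_marches_def)
    show "y_line (orbit ?f p n) = y_line (orbit e p n)" by (simp only: eq order_refl)
    have "y_of (orbit e p n) = b" using e by (simp add: B_def)
    then show "e \<in> T n \<or> ?f \<in> T n"
      unfolding T_def mem_Collect_eq orbit_Suc eq[OF order_refl] env_map_coordinates flip_apply by simp
  qed measurable
  have "AE e in fair_bits. finite {n. e \<in> B n}"
  proof (rule AE_finitely_many_trials[where T="\<lambda>n. B n \<inter> T n", OF fair_bits.prob_space_axioms _ _ le])
    fix e m n assume "m < n" and e: "e \<in> B m \<inter> T m"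
    have "y_of (orbit e p (Suc m)) = b + 1"
      using e by (simp only: T_def Int_iff mem_Collect_eq)
    then have "\<not> (\<forall>k\<le>n. y_of (orbit e p k) \<le> b)" using \<open>m < n\<close> by (metis Suc_leI zle_add1_eq_le less_irrefl)
    then show "e \<notin> B n \<inter> T n" by (simp only: B_def Int_iff mem_Collect_eq simp_thms not_False_eq_True)
  qed (auto simp: meas)
  then show ?thesis by (simp only: B_def mem_Collect_eq)
qed

section \<open>The first coordinate is bounded above along orbits\<close>

text \<open>On a march without end only finitely many lines in direction \<open>x\<close> would be met, so \<open>y\<close> would take
finitely many values. Let \<open>b\<close> be the largest value taken infinitely often. After some
time \<open>b\<close> is never exceeded, and the path restarted at that time visits its maximal height \<open>b\<close>
infinitely often.\<close>
lemma no_eternal_x_march: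
  assumes new: "finite {n. x_marches e q n \<and> (\<forall>k<n. x_line (orbit e q k) \<noteq> x_line (orbit e q n))}"
    and top: "\<And>r b. finite {n. x_marches e r n \<and> (\<forall>k\<le>n. y_of (orbit e r k) \<le> b) \<and> y_of (orbit e r n) = b}"
  shows "\<exists>n. \<not> x_marches e q n"
proof (rule ccontr)
  assume "\<not> ?thesis"
  then have march: "x_marches e q n" for n by blast
  define y where "y n = y_of (orbit e q n)" for n
  define l where "l n = x_line (orbit e q n)" for n
  let ?S = "{n. \<forall>k<n. l k \<noteq> l n}"
  \<comment> \<open>Every line on the path is also met at a time when it is new.\<close>
  have "l n \<in> l ` ?S" for n
  proof -
    let ?k = "LEAST k. l k = l n"
    have k: "l ?k = l n" by (rule LeastI) simp
    have "?k \<in> ?S" unfolding k mem_Collect_eq using not_less_Least[of _ "\<lambda>k. l k = l n"] by blast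
    from rev_image_eqI[of ?k ?S _ l, OF this k[symmetric]] show ?thesis .
  qed
  then have "range l \<subseteq> l ` ?S" by blast
  moreover have "finite ?S" using new march by (simp add: l_def)
  ultimately have "finite (range l)" using finite_surj by blast
  moreover have "y_of p = fst (projl (x_line p))" for p by (cases p) simp
  then have "range y = (fst \<circ> projl) ` range l" by (auto simp: y_def l_def image_image)
  ultimately have fin: "finite (range y)" by simp
  define I where "I = {v. infinite {n. y n = v}}"
  have "I \<subseteq> range y" 
  proof
    fix v assume "v \<in> I"
    then have "{n. y n = v} \<noteq> {}" unfolding I_def by (metis finite.emptyI mem_Collect_eq)
    then show "v \<in> range y" by auto
  qed
  then have "finite I" using fin finite_subset by blast
  have "I \<noteq> {}"
  proof
    assume "I = {}"
    then have "finite (\<Union>v\<in>range y. {n. y n = v})" using fin by (intro finite_UN_I) (auto simp: I_def)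
    moreover have "(\<Union>v\<in>range y. {n. y n = v}) = UNIV" by auto
    ultimately show False by simp
  qed
  define b where "b = Max I"
  have "b \<in> I" unfolding b_def using \<open>finite I\<close> \<open>I \<noteq> {}\<close> by (rule Max_in)
  have "finite (\<Union>v\<in>{v \<in> range y. b < v}. {n. y n = v})"
  proof (rule finite_UN_I)
    fix v assume "v \<in> {v \<in> range y. b < v}"
    then have "v \<notin> I" unfolding b_def using \<open>finite I\<close> by (metis (no_types, lifting) Max_ge mem_Collect_eq not_le)
    then show "finite {n. y n = v}" by (simp add: I_def)
  qed (use fin in simp)
  moreover have "(\<Union>v\<in>{v \<in> range y. b < v}. {n. y n = v}) = {n. b < y n}" by auto
  ultimately obtain N where N: "\<forall>n\<in>{n. b < y n}. n < N" using finite_nat_set_iff_bounded by metis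
  define r where "r = orbit e q N"
  have r: "orbit e r k = orbit e q (N + k)" for k by (simp only: r_def orbit_add)
  have x: "x_of (orbit e q k) = x_of q + int k" for k using march[of k] by (simp add: x_marches_def)
  have "x_marches e r n" for n unfolding x_marches_def r x unfolding r_def x by simp
  moreover have "y_of (orbit e r k) \<le> b" for k 
    unfolding r y_def[symmetric] using N by (metis mem_Collect_eq not_less not_add_less1)
  ultimately have "finite {n. y_of (orbit e r n) = b}" using top[of r b] by simp
  then have "finite ((\<lambda>n. N + n) ` {n. y (N + n) = b} \<union> {..<N})" unfolding r by (fold y_def) simp
  moreover have "{n. y n = b} \<subseteq> (\<lambda>n. N + n) ` {n. y (N + n) = b} \<union> {..<N}"
  proof
    fix n assume n: "n \<in> {n. y n = b}"
    show "n \<in> (\<lambda>n. N + n) ` {n. y (N + n) = b} \<union> {..<N}"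
    proof (cases "n < N")
      case False
      then have "n = N + (n - N)" by simp
      then show ?thesis using n by (metis (mono_tags, lifting) UnI1 imageI mem_Collect_eq)
    qed simp
  qed
  ultimately have "finite {n. y n = b}" using finite_subset by blast
  then show False using \<open>b \<in> I\<close> by (simp add: I_def)
qed

text \<open>If \<open>x\<close> is unbounded above, there are records at arbitrarily late times. Once no record is
followed by a retreat, the step after a record gives a record again, so the path marches forever.\<close>
lemma x_bounded_above_if_no_eternal_march:
  assumes ret: "finite {n. x_record e p (Suc n) \<and> x_of (orbit e p (Suc (Suc n))) < x_of (orbit e p (Suc n))}"
    and march: "\<And>q. \<exists>n. \<not> x_marches e q n"
  shows "\<exists>M. \<forall>n. x_of (orbit e p n) \<le> M"
proof (rule ccontr)
  assume "\<not> ?thesis"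
  then have unbounded: "\<exists>n. M < x_of (orbit e p n)" for M by (meson not_le)
  define x where "x n = x_of (orbit e p n)" for n
  obtain N where "\<forall>n\<in>{n. x_record e p (Suc n) \<and> x (Suc (Suc n)) < x (Suc n)}. n < N"
    using ret unfolding x_def[symmetric] finite_nat_set_iff_bounded by blast
  then have N: "\<not> x (Suc (Suc n)) < x (Suc n)" if "N \<le> n" "x_record e p (Suc n)" for n 
    using that by (metis (mono_tags, lifting) mem_Collect_eq not_le)
  have step: "x_record e p (Suc (Suc n)) \<and> x (Suc (Suc n)) = x (Suc n) + 1"
    if "N \<le> n" "x_record e p (Suc n)" for n
  proof -
    have "x (Suc (Suc n)) = x (Suc n) + unit_step (e (x_line (orbit e p (Suc n))))"
      by (simp only: x_def orbit_Suc[of "Suc n"] env_map_coordinates)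
    with N[OF that] have "x (Suc (Suc n)) = x (Suc n) + 1" by (simp split: if_splits)
    moreover from this that(2) have "x_record e p (Suc (Suc n))"
      unfolding x_record_def x_def[symmetric] by (auto simp: less_Suc_eq)
    ultimately show ?thesis by blast
  qed
  let ?M = "Max (x ` {..N})"
  obtain k where k: "?M < x k" and least: "\<And>j. j < k \<Longrightarrow> \<not> ?M < x j"
    using unbounded[of ?M] exists_least_iff[of "\<lambda>n. ?M < x n"] unfolding x_def[symmetric] by blast
  have "x j \<le> ?M" if "j \<le> N" for j using that by (intro Max_ge) auto
  then have "N < k" using k by (metis leD not_le)
  moreover have "x_record e p k"
    unfolding x_record_def x_def[symmetric] using k least by (meson le_less_trans not_le)
  ultimately obtain m where m: "N \<le> m" "x_record e p (Suc m)" by (metis less_Suc_eq_le less_imp_Suc_add add.commute le_add1)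
  have all: "x_record e p (Suc (m + j)) \<and> x (Suc m + j) = x (Suc m) + int j" for j
  proof (induction j)
    case (Suc j)
    then show ?case using step[of "m + j"] m(1) by simp
  qed (use m in simp)
  define q where "q = orbit e p (Suc m)"
  have q: "orbit e q j = orbit e p (Suc m + j)" for j by (simp only: q_def orbit_add)
  have "x_of (orbit e q j) = x_of q + int j" for j
    using all[of j] unfolding q unfolding q_def x_def by blast
  then have "x_marches e q n" for n by (simp add: x_marches_def)
  then show False using march[of q] by blast
qed

definition bounded_above_along_orbits :: "(point \<Rightarrow> int) \<Rightarrow> bool" where
  "bounded_above_along_orbits h \<longleftrightarrow> (AE e in fair_bits. \<forall>p. \<exists>M. \<forall>n. h (orbit e p n) \<le> M)"

lemma x_bounded_above_along_orbits: "bounded_above_along_orbits x_of"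
proof -
  have "AE e in fair_bits. \<forall>p. finite {n. x_record e p (Suc n) \<and> x_of (orbit e p (Suc (Suc n))) < x_of (orbit e p (Suc n))}"
    unfolding AE_all_countable using AE_finitely_many_records_followed_by_retreat by blast
  moreover have "AE e in fair_bits. \<forall>p. finite {n. x_marches e p n \<and> (\<forall>k<n. x_line (orbit e p k) \<noteq> x_line (orbit e p n))}"
    unfolding AE_all_countable using AE_finitely_many_new_lines_on_march by blast
  moreover have "AE e in fair_bits. \<forall>p b. finite {n. x_marches e p n \<and> (\<forall>k\<le>n. y_of (orbit e p k) \<le> b) \<and> y_of (orbit e p n) = b}"
    unfolding AE_all_countable using AE_finitely_many_visits_to_maximal_y_on_march by blast
  ultimately show ?thesis unfolding bounded_above_along_orbits_def
  proof eventually_elim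
    case (elim e)
    have "\<exists>n. \<not> x_marches e q n" for q by (rule no_eternal_x_march) (use elim in blast)+
    then show ?case using x_bounded_above_if_no_eternal_march elim(1) by blast
  qed
qed

section \<open>Symmetries and boundedness of orbits\<close>

text \<open>A map \<open>g\<close> of the lattice is a symmetry of the model if it conjugates the step map of an environment
to that of a transformed environment \<open>\<tau> e\<close> with the same law.\<close>
definition lattice_symmetry :: "(point \<Rightarrow> point) \<Rightarrow> (env \<Rightarrow> env) \<Rightarrow> bool" where
  "lattice_symmetry g \<tau> \<longleftrightarrow> \<tau> \<in> fair_bits \<rightarrow>\<^sub>M fair_bits \<and> distr fair_bits fair_bits \<tau> = fair_bits \<and>
     (\<forall>e p. env_map (\<tau> e) (g p) = g (env_map e p))"

lemma lattice_symmetryI: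
  assumes "inj \<pi>" and "\<And>e p. env_map (\<lambda>i. e (\<pi> i) \<noteq> c i) (g p) = g (env_map e p)"
  shows "lattice_symmetry g (\<lambda>e i. e (\<pi> i) \<noteq> c i)"
proof -
  have "(\<lambda>e i. e (\<pi> i) \<noteq> c i) \<in> fair_bits \<rightarrow>\<^sub>M fair_bits"
    by (rule measurable_to_fair_bits) simp
  then show ?thesis
    using assms(2) distr_reindex_xor[OF assms(1)] unfolding lattice_symmetry_def by blast
qed

lemma lattice_symmetry_orbit:
  assumes "lattice_symmetry g \<tau>"
  shows "orbit (\<tau> e) (g p) n = g (orbit e p n)"
proof (induction n)
  case (Suc n)
  have "env_map (\<tau> e) (g q) = g (env_map e q)" for q
    using assms unfolding lattice_symmetry_def by blast
  then show ?case by (simp only: orbit_Suc Suc)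
qed simp

lemma bounded_above_along_orbits_symmetry:
  assumes sym: "lattice_symmetry g \<tau>" and "bounded_above_along_orbits h"
  shows "bounded_above_along_orbits (\<lambda>p. h (g p))"
proof -
  have "AE e in distr fair_bits fair_bits \<tau>. \<forall>p. \<exists>M. \<forall>n. h (orbit e p n) \<le> M"
    using assms by (simp only: lattice_symmetry_def bounded_above_along_orbits_def)
  then have "AE e in fair_bits. \<forall>p. \<exists>M. \<forall>n. h (orbit (\<tau> e) p n) \<le> M"
    using sym by (intro AE_distrD[of \<tau> fair_bits fair_bits]) (auto simp: lattice_symmetry_def)
  then show ?thesis unfolding bounded_above_along_orbits_def
  proof eventually_elim
    case (elim e)
    then show ?case unfolding lattice_symmetry_orbit[OF sym, symmetric] by blast
  qed
qed

fun reflect_x :: "point \<Rightarrow> point" where "reflect_x (x, y, z) = (- x, y, z)"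

text \<open>The reflection also reverses the lines in direction \<open>x\<close>; this is the term \<open>isl i\<close> in the symmetry.\<close>
fun reflect_line :: "line \<Rightarrow> line" where
  "reflect_line (Inl (y, z)) = Inl (y, z)"
| "reflect_line (Inr (Inl (x, z))) = Inr (Inl (- x, z))"
| "reflect_line (Inr (Inr (x, y))) = Inr (Inr (- x, y))"

lemma symmetry_reflect_x: "lattice_symmetry reflect_x (\<lambda>e i. e (reflect_line i) \<noteq> isl i)"
proof (rule lattice_symmetryI)
  have "reflect_line (reflect_line i) = i" for i by (cases i rule: reflect_line.cases) auto
  then show "inj reflect_line" by (metis injI)
  show "env_map (\<lambda>i. e (reflect_line i) \<noteq> isl i) (reflect_x p) = reflect_x (env_map e p)" for e p
    by (cases p) (simp add: env_map_def line_map_def)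
qed

fun rotate_axes :: "point \<Rightarrow> point" where "rotate_axes (x, y, z) = (y, z, x)"

text \<open>The line that the cyclic permutation of the axes carries to the given one. The constant coordinates
change places where the permutation reverses their order.\<close>
fun rotate_line :: "line \<Rightarrow> line" where
  "rotate_line (Inl (a, b)) = Inr (Inl (b, a))"
| "rotate_line (Inr (Inl (a, b))) = Inr (Inr (b, a))"
| "rotate_line (Inr (Inr (a, b))) = Inl (a, b)"

lemma symmetry_rotate_axes: "lattice_symmetry rotate_axes (\<lambda>e i. e (rotate_line i) \<noteq> False)"
proof (rule lattice_symmetryI)
  show "inj rotate_line"
  proof (rule injI)
    fix i j assume "rotate_line i = rotate_line j"
    then show "i = j" by (cases i rule: rotate_line.cases; cases j rule: rotate_line.cases; simp)
  qed
  show "env_map (\<lambda>i. e (rotate_line i) \<noteq> False) (rotate_axes p) = rotate_axes (env_map e p)" for e p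
    by (cases p) (simp add: env_map_def line_map_def)
qed

fun translate_line :: "point \<Rightarrow> line \<Rightarrow> line" where
  "translate_line (a, b, c) (Inl (y, z)) = Inl (y - b, z - c)"
| "translate_line (a, b, c) (Inr (Inl (x, z))) = Inr (Inl (x - a, z - c))"
| "translate_line (a, b, c) (Inr (Inr (x, y))) = Inr (Inr (x - a, y - b))"

lemma symmetry_translate: "lattice_symmetry (\<lambda>p. p + t) (\<lambda>e i. e (translate_line t i) \<noteq> False)"
proof (rule lattice_symmetryI)
  obtain a b c where t: "t = (a, b, c)" by (cases t)
  show "inj (translate_line t)"
  proof (rule injI)
    fix i j assume "translate_line t i = translate_line t j"
    then show "i = j" unfolding t by (cases "(t, i)" rule: translate_line.cases; cases "(t, j)" rule: translate_line.cases; simp add: t)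
  qed
  show "env_map (\<lambda>i. e (translate_line t i) \<noteq> False) (p + t) = env_map e p + t" for e p
    by (cases p) (simp add: env_map_def line_map_def t)
qed

text \<open>The statement about \<open>x\<close> is carried to the other five directions by the reflection \<open>x \<mapsto> -x\<close>
and the cyclic permutation of the axes.\<close>
lemma all_coordinates_bounded_above:
  "bounded_above_along_orbits x_of" "bounded_above_along_orbits y_of" "bounded_above_along_orbits z_of"
  "bounded_above_along_orbits (\<lambda>p. - x_of p)" "bounded_above_along_orbits (\<lambda>p. - y_of p)"
  "bounded_above_along_orbits (\<lambda>p. - z_of p)"
proof -
  have reflect: "x_of (reflect_x p) = - x_of p" for p by (cases p) simp
  have rotate: "x_of (rotate_axes p) = y_of p" "y_of (rotate_axes p) = z_of p" for p by (cases p; simp)+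
  note rot = bounded_above_along_orbits_symmetry[OF symmetry_rotate_axes]
  show x: "bounded_above_along_orbits x_of" by (rule x_bounded_above_along_orbits)
  show y: "bounded_above_along_orbits y_of" using rot[OF x] by (simp only: rotate)
  show "bounded_above_along_orbits z_of" using rot[OF y] by (simp only: rotate)
  show x': "bounded_above_along_orbits (\<lambda>p. - x_of p)"
    using bounded_above_along_orbits_symmetry[OF symmetry_reflect_x x] by (simp only: reflect)
  show y': "bounded_above_along_orbits (\<lambda>p. - y_of p)" using rot[OF x'] by (simp only: rotate)
  show "bounded_above_along_orbits (\<lambda>p. - z_of p)" using rot[OF y'] by (simp only: rotate)
qed

lemma AE_orbits_reach_cycles: "AE e in fair_bits. \<forall>p. \<exists>n L. 1 \<le> L \<and> orbit e (orbit e p n) L = orbit e p n"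
  using all_coordinates_bounded_above unfolding bounded_above_along_orbits_def
proof eventually_elim
  case (elim e)
  show ?case
  proof
    fix p
    have fin: "finite (range (\<lambda>n. h (orbit e p n)))" 
      if ub: "\<exists>M. \<forall>n. h (orbit e p n) \<le> M" and lb: "\<exists>M. \<forall>n. - h (orbit e p n) \<le> M" for h :: "point \<Rightarrow> int"
    proof -
      obtain M where M: "\<forall>n. h (orbit e p n) \<le> M" using ub ..
      obtain M' where M': "\<forall>n. - h (orbit e p n) \<le> M'" using lb ..
      then have "range (\<lambda>n. h (orbit e p n)) \<subseteq> {- M'..M}" using M M' by (simp add: image_subset_iff minus_le_iff)
      then show ?thesis by (rule finite_subset) simp
    qed
    have coords: "(x_of q, y_of q, z_of q) = q" for q by (cases q) simp
    have "range (orbit e p) \<subseteq> range (\<lambda>n. x_of (orbit e p n)) \<times> range (\<lambda>n. y_of (orbit e p n)) \<times> range (\<lambda>n. z_of (orbit e p n))"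
    proof (rule image_subsetI)
      fix n
      have "(x_of (orbit e p n), y_of (orbit e p n), z_of (orbit e p n)) \<in> range (\<lambda>n. x_of (orbit e p n)) \<times> range (\<lambda>n. y_of (orbit e p n)) \<times> range (\<lambda>n. z_of (orbit e p n))"
        by (intro SigmaI rangeI)
      then show "orbit e p n \<in> range (\<lambda>n. x_of (orbit e p n)) \<times> range (\<lambda>n. y_of (orbit e p n)) \<times> range (\<lambda>n. z_of (orbit e p n))"
        by (simp only: coords)
    qed
    moreover have "finite (range (\<lambda>n. x_of (orbit e p n)))" by (rule fin[OF elim(1,4)[rule_format]])
    moreover have "finite (range (\<lambda>n. y_of (orbit e p n)))" by (rule fin[OF elim(2,5)[rule_format]])
    moreover have "finite (range (\<lambda>n. z_of (orbit e p n)))" by (rule fin[OF elim(3,6)[rule_format]])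
    ultimately have "finite (range (orbit e p))" by (meson finite_SigmaI finite_subset)
    then have "\<not> inj (orbit e p)" using finite_imageD infinite_UNIV_nat by blast
    then obtain i j where ij: "i < j" "orbit e p i = orbit e p j" 
      using linorder_injI[of "orbit e p"] by blast
    have "orbit e (orbit e p i) (j - i) = orbit e p (i + (j - i))" by (simp only: orbit_add)
    also have "\<dots> = orbit e p i" using ij by simp
    finally have "orbit e (orbit e p i) (j - i) = orbit e p i" .
    then show "\<exists>n L. 1 \<le> L \<and> orbit e (orbit e p n) L = orbit e p n" using ij(1) by (intro exI[of _ i] exI[of _ "j - i"]) simp
  qed
qed

section \<open>Finite basins by mass transport\<close>

text \<open>Here \<open>L\<close> is some return time of \<open>c\<close>, not necessarily the minimal one.\<close>
definition reaches_cycle_at :: "('a \<Rightarrow> 'a) \<Rightarrow> nat \<Rightarrow> 'a \<Rightarrow> 'a \<Rightarrow> bool" where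
  "reaches_cycle_at F L a c \<longleftrightarrow> (\<exists>n. (F ^^ n) a = c) \<and> (F ^^ L) c = c"

lemma card_reached_cycle:
  assumes "1 \<le> L"
  shows "finite {c. reaches_cycle_at F L a c} \<and> card {c. reaches_cycle_at F L a c} \<le> L"
proof (cases "{c. reaches_cycle_at F L a c} = {}")
  case False
  let ?P = "\<lambda>n. (F ^^ L) ((F ^^ n) a) = (F ^^ n) a"
  have "\<exists>n. ?P n" using False by (auto simp: reaches_cycle_at_def)
  then obtain m where m: "?P m" and least: "\<And>n. ?P n \<Longrightarrow> m \<le> n"
    using LeastI_ex[of ?P] Least_le[of ?P] by blast
  have "{c. reaches_cycle_at F L a c} \<subseteq> (\<lambda>i. (F ^^ i) ((F ^^ m) a)) ` {..<L}"
  proof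
    fix c assume "c \<in> {c. reaches_cycle_at F L a c}"
    then obtain n where n: "(F ^^ n) a = c" "?P n" by (auto simp: reaches_cycle_at_def)
    then have "m \<le> n" by (intro least)
    have "c = (F ^^ (n - m)) ((F ^^ m) a)" 
      using n(1) \<open>m \<le> n\<close> by (simp flip: funpow_add[THEN fun_cong, unfolded comp_apply])
    also have "\<dots> = (F ^^ ((n - m) mod L)) ((F ^^ m) a)" using funpow_mod_eq[OF m] by simp
    finally show "c \<in> (\<lambda>i. (F ^^ i) ((F ^^ m) a)) ` {..<L}" using assms by auto
  qed
  then show ?thesis using finite_subset surj_card_le[of "{..<L}"] by fastforce
qed simp

text \<open>Mass transport: by translation invariance, the expected number of points \<open>a\<close> that reach \<open>c\<close>,
counted only if \<open>L\<close> is a return time of \<open>c\<close>, equals the expected number of points \<open>d\<close> of return time \<open>L\<close> that are reached from \<open>c\<close>. The latter is at most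
\<open>L\<close>, since such points all lie on one cycle.\<close>
lemma AE_finite_basin:
  assumes L: "1 \<le> L"
  shows "AE e in fair_bits. finite {a. reaches_cycle_at (env_map e) L a c}"
proof -
  define A where "A a d = {e. reaches_cycle_at (env_map e) L a d}" for a d
  have A [measurable]: "A a d \<in> sets fair_bits" for a d
  proof -
    have "Measurable.pred fair_bits (\<lambda>e. (\<exists>n. orbit e a n = d) \<and> orbit e d L = d)"
      by (intro pred_intros_countable pred_intros_logic pred_orbit)
    then show ?thesis by (simp only: A_def reaches_cycle_at_def pred_def space_fair_bits UNIV_I simp_thms)
  qed
  have shift: "emeasure fair_bits (A a c) = emeasure fair_bits (A c (c + c - a))" for a
  proof -
    \<comment> \<open>The translation taking \<open>a\<close> to \<open>c\<close> takes \<open>c\<close> to \<open>c + c - a\<close>.\<close>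
    define \<tau> where "\<tau> = (\<lambda>e i. e (translate_line (c - a) i) \<noteq> False)"
    have sym: "lattice_symmetry (\<lambda>p. p + (c - a)) \<tau>" unfolding \<tau>_def by (rule symmetry_translate)
    then have [measurable]: "\<tau> \<in> fair_bits \<rightarrow>\<^sub>M fair_bits" and d: "distr fair_bits fair_bits \<tau> = fair_bits"
      by (simp_all add: lattice_symmetry_def)
    have "emeasure fair_bits (A c (c + c - a)) = emeasure fair_bits (\<tau> -` A c (c + c - a) \<inter> space fair_bits)"
      by (subst d[symmetric], rule emeasure_distr) measurable
    also have "\<tau> -` A c (c + c - a) \<inter> space fair_bits = A a c"
    proof -
      have o: "orbit (\<tau> e) c n = orbit e a n + (c - a)" "orbit (\<tau> e) (c + c - a) n = orbit e c n + (c - a)" for e n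
        using lattice_symmetry_orbit[OF sym, where p=a] lattice_symmetry_orbit[OF sym, where p=c] by (simp_all add: algebra_simps)
      have "q + (c - a) = c + c - a \<longleftrightarrow> q = c" for q :: point by (metis add_diff_eq add_right_cancel)
      then show ?thesis by (simp add: A_def reaches_cycle_at_def vimage_def o)
    qed
    finally show ?thesis ..
  qed
  have bij: "bij_betw (\<lambda>a. c + c - a) UNIV (UNIV :: point set)"
    by (rule bij_betw_byWitness[where f'="\<lambda>a. c + c - a"]) auto
  have "(\<integral>\<^sup>+a. emeasure fair_bits (A a c) \<partial>count_space UNIV) = (\<integral>\<^sup>+d. emeasure fair_bits (A c d) \<partial>count_space UNIV)"
    unfolding shift by (rule nn_integral_bij_count_space[OF bij])
  also have "\<dots> = (\<integral>\<^sup>+e. \<integral>\<^sup>+d. indicator (A c d) e \<partial>count_space UNIV \<partial>fair_bits)"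
    by (subst nn_integral_count_space_nn_integral) auto
  also have "\<dots> \<le> (\<integral>\<^sup>+e. of_nat L \<partial>(fair_bits :: env measure))"
  proof (rule nn_integral_mono)
    fix e
    have "(\<integral>\<^sup>+d. indicator (A c d) e \<partial>count_space UNIV) = (\<integral>\<^sup>+d. indicator {d. e \<in> A c d} d \<partial>count_space UNIV)"
      by (intro nn_integral_cong) (simp add: indicator_def)
    also have "\<dots> = emeasure (count_space UNIV) {d. e \<in> A c d}" by simp
    also have "\<dots> \<le> of_nat L"
      using card_reached_cycle[OF L, of "env_map e" c] by (simp add: A_def emeasure_count_space)
    finally show "(\<integral>\<^sup>+d. indicator (A c d) e \<partial>count_space UNIV) \<le> of_nat L" .
  qed
  also have "\<dots> < \<infinity>"
  proof -
    have "emeasure (fair_bits :: env measure) UNIV = 1"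
      using fair_bits.emeasure_space_1 by (simp only: space_fair_bits)
    then show ?thesis by (simp add: of_nat_less_top)
  qed
  finally have "AE e in fair_bits. finite {a. e \<in> A a c}" by (intro AE_finite_occurrences) (auto intro: A)
  then show ?thesis by (simp only: A_def mem_Collect_eq)
qed

text \<open>Crossing an arc in either direction does not change the cycle that is eventually reached: against
the arc this is clear, and along the arc one may first go once more around the cycle.\<close>
lemma component_reaches_same_cycle:
  assumes C: "C \<in> connected_components (functional_digraph F)"
    and u: "u \<in> verts C" "reaches_cycle_at F L u c" and L: "1 \<le> L" and v: "v \<in> verts C"
  shows "reaches_cycle_at F L v c"
proof -
  have sub: "subgraph C (functional_digraph F)" and conn: "Digraph_Component.connected C"
    using C by (auto simp: connected_components_def pre_digraph.max_subgraph_def)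
  have arc: "t = F s \<or> s = F t" if "(s, t) \<in> arcs_ends (with_proj (mk_symmetric C))" for s t
  proof -
    have "(s, t) \<in> (\<Union>a\<in>arcs C. {(tail C a, head C a), (head C a, tail C a)})"
      using that by (simp add: parcs_mk_symmetric)
    moreover have "head C a = F (tail C a)" if "a \<in> arcs C" for a
      using sub that by (auto simp: subgraph_def compatible_def functional_digraph_def)
    ultimately show ?thesis by auto
  qed
  have "u \<rightarrow>\<^sup>*\<^bsub>with_proj (mk_symmetric C)\<^esub> v"
    using conn u(1) v by (simp add: connected_def strongly_connected_def)
  then have "(u, v) \<in> (arcs_ends (with_proj (mk_symmetric C)))\<^sup>*" by (rule reachable_rtranclI)
  then show ?thesis
  proof (induction rule: rtrancl_induct)
    case base
    show ?case by (rule u(2))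
  next
    case (step s t)
    obtain n where n: "(F ^^ n) s = c" and c: "(F ^^ L) c = c" using step.IH by (auto simp: reaches_cycle_at_def)
    have "\<exists>k. (F ^^ k) t = c"
    proof (cases "t = F s")
      case True
      have "(F ^^ (n + L - 1)) t = (F ^^ Suc (n + L - 1)) s" by (simp only: True funpow_Suc_right comp_apply)
      also have "Suc (n + L - 1) = L + n" using L by simp
      also have "(F ^^ (L + n)) s = c" by (simp only: funpow_add comp_apply n c)
      finally show ?thesis by blast
    next
      case False
      then have "s = F t" using arc[OF step.hyps(2)] by blast
      then have "(F ^^ Suc n) t = c" using n by (simp only: funpow_Suc_right comp_apply)
      then show ?thesis by blast
    qed
    then show ?case using c by (simp add: reaches_cycle_at_def)
  qed
qed

section \<open>Orbits and components in the given random environment\<close>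

lemma path_from_origin_eq: "path_from_origin F n = (F ^^ n) (0, 0, 0)"
  by (induction n) simp_all

theorem theorem3:
  fixes M :: "'a measure"
    and U V W :: "int \<times> int \<Rightarrow> 'a \<Rightarrow> int"
  assumes "prob_space M"
    and "prob_space.indep_vars M (\<lambda>_. count_space {-1, 1})
           (case_sum U (case_sum V W)) (UNIV :: (int \<times> int + int \<times> int + int \<times> int) set)"
    and "\<And>l s. s \<in> {-1, 1} \<Longrightarrow> measure M {\<omega> \<in> space M. U l \<omega> = s} = 1 / 2"
    and "\<And>l s. s \<in> {-1, 1} \<Longrightarrow> measure M {\<omega> \<in> space M. V l \<omega> = s} = 1 / 2"
    and "\<And>l s. s \<in> {-1, 1} \<Longrightarrow> measure M {\<omega> \<in> space M. W l \<omega> = s} = 1 / 2"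
  defines "F \<equiv> \<lambda>\<omega>. line_map (\<lambda>l. U l \<omega>) (\<lambda>l. V l \<omega>) (\<lambda>l. W l \<omega>)"
  shows "(AE \<omega> in M. eventually_periodic (path_from_origin (F \<omega>))) \<and>
         (AE \<omega> in M. \<forall>C \<in> connected_components (functional_digraph (F \<omega>)).
            bounded_points (verts C))"
proof -
  interpret prob_space M by fact
  define X where "X = case_sum U (case_sum V W)"
  define bits where "bits = (\<lambda>\<omega> i. X i \<omega> = 1)"
  have X: "indep_vars (\<lambda>_. count_space {-1, 1}) X UNIV" using assms(2) by (simp only: X_def)
  then have rv: "random_variable (count_space {-1, 1}) (X i)" for i by (simp add: indep_vars_def)
  from X have indep: "indep_vars (\<lambda>_. count_space UNIV) (\<lambda>i \<omega>. X i \<omega> = 1) UNIV"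
    by (rule indep_vars_compose2) simp
  have "prob {\<omega> \<in> space M. X i \<omega> = 1} = 1 / 2" for i
    using assms(3-5)[of 1] by (auto simp: X_def split: sum.split)
  then have distr: "distr M fair_bits bits = fair_bits"
    unfolding bits_def using indep by (intro distr_eq_fair_bits prob_space_axioms)
  have bits: "bits \<in> M \<rightarrow>\<^sub>M fair_bits"
    unfolding bits_def by (intro measurable_to_fair_bits measurable_compose[OF rv]) simp
  have pull_back: "AE \<omega> in M. P (bits \<omega>)" if "AE e in fair_bits. P e" for P
    using AE_distrD[OF bits, of P] that unfolding distr by blast
  have F: "F \<omega> = env_map (bits \<omega>)" if "\<omega> \<in> space M" for \<omega>
  proof -
    have "X i \<omega> = unit_step (bits \<omega> i)" for i
      using measurable_space[OF rv that, of i] by (auto simp: bits_def)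
    from this[of "Inl _"] this[of "Inr (Inl _)"] this[of "Inr (Inr _)"] show ?thesis
      unfolding F_def env_map_def X_def by simp
  qed
  have cycles: "AE \<omega> in M. \<forall>p. \<exists>n L. 1 \<le> L \<and> orbit (bits \<omega>) (orbit (bits \<omega>) p n) L = orbit (bits \<omega>) p n"
    by (rule pull_back[OF AE_orbits_reach_cycles])
  have "AE \<omega> in M. finite {a. reaches_cycle_at (env_map (bits \<omega>)) (Suc L) a c}" for L c
    by (rule pull_back[OF AE_finite_basin]) simp
  then have basins: "AE \<omega> in M. \<forall>L c. finite {a. reaches_cycle_at (env_map (bits \<omega>)) (Suc L) a c}"
    by (simp add: AE_all_countable)
  show ?thesis
  proof (intro conjI)
    show "AE \<omega> in M. eventually_periodic (path_from_origin (F \<omega>))"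
      using cycles AE_space
    proof eventually_elim
      case (elim \<omega>)
      obtain n L where L: "1 \<le> L" and c: "orbit (bits \<omega>) (orbit (bits \<omega>) (0, 0, 0) n) L = orbit (bits \<omega>) (0, 0, 0) n"
        using elim(1) by blast
      have "orbit (bits \<omega>) (0, 0, 0) (m + L) = orbit (bits \<omega>) (0, 0, 0) m" if "n \<le> m" for m
      proof -
        have "m + L = (n + L) + (m - n)" using that by simp
        then have "orbit (bits \<omega>) (0, 0, 0) (m + L) = orbit (bits \<omega>) (orbit (bits \<omega>) (orbit (bits \<omega>) (0, 0, 0) n) L) (m - n)"
          by (simp only: orbit_add)
        also have "\<dots> = orbit (bits \<omega>) (0, 0, 0) (n + (m - n))" by (simp only: c orbit_add)
        finally show ?thesis using that by simp
      qed
      then show ?case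
        unfolding eventually_periodic_def path_from_origin_eq F[OF elim(2)] using L by blast
    qed
    show "AE \<omega> in M. \<forall>C \<in> connected_components (functional_digraph (F \<omega>)). bounded_points (verts C)"
      using cycles basins AE_space
    proof eventually_elim
      case (elim \<omega>)
      show ?case
      proof
        fix C assume C: "C \<in> connected_components (functional_digraph (F \<omega>))"
        then have "verts C \<noteq> {}"
          by (auto simp: connected_components_def pre_digraph.max_subgraph_def connected_def strongly_connected_def)
        then obtain u where u: "u \<in> verts C" by blast
        obtain n L where L: "1 \<le> L" and c: "orbit (bits \<omega>) (orbit (bits \<omega>) u n) L = orbit (bits \<omega>) u n"
          using elim(1) by blast
        let ?c = "orbit (bits \<omega>) u n"
        have "reaches_cycle_at (F \<omega>) L u ?c" using c by (auto simp: reaches_cycle_at_def F[OF elim(3)])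
        then have "verts C \<subseteq> {a. reaches_cycle_at (F \<omega>) L a ?c}"
          using component_reaches_same_cycle[OF C u _ L] by blast
        moreover have "finite {a. reaches_cycle_at (F \<omega>) L a ?c}"
          using elim(2) L by (metis F[OF elim(3)] Suc_pred' less_eq_Suc_le One_nat_def)
        ultimately have "finite (verts C)" by (rule finite_subset)
        then show "bounded_points (verts C)" unfolding bounded_points_def by (intro finite_imp_bounded finite_imageI)
      qed
    qed
  qed
qed

end
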